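(* Suppose that $\mathcal A\mathcal A^*$ is nonsingular and that the Slater condition holds for (P), i.e. there exists $X^\dagger\in\mathbb S^n$ with $\mathcal A(X^\dagger)=b$ and $X^\dagger\succ0$. Then the modified limited-memory BFGS algorithm described in the context, applied to $\min_{\xi\in\mathbb R^m}\phi(\xi)$, is well defined (whenever $\nabla\phi(\xi^k)\neq0$, the direction $d^k$ is a descent direction and the line search in Step 2 terminates). Let $\{\xi^k\}$ be the sequence generated by the algorithm, and suppose that $\nabla\phi(\xi^k)\ne0$ for all $k\ge0$. Then the sequence $\{\xi^k\}$ is bounded, and any accumulation point $\hat\xi$ of this sequence is an optimal solution of $\min_{\xi\in\mathbb R^m}\phi(\xi)$.
   Context: $\mathbb S^n$ is the space of real symmetric $n\times n$ matrices with trace inner product and Frobenius norm; $\mathbb S^n_+$ is the cone of positive semidefinite matrices and $\Pi_{\mathbb S^n_+}$ the orthogonal projection onto it. Let $C\in\mathbb S^n$, $b\in\mathbb R^m$, and $\mathcal A:\mathbb S^n\to\mathbb R^m$ linear with adjoint $\mathcal A^*$. The semidefinite program is (P) $\min_{X\in\mathbb S^n}\{\langle C,X\rangle:\mathcal A(X)=b,\ X\succeq0\}$. For a given $Z\in\mathbb S^n$, projecting $Z$ onto the feasible set of (P) leads to the dual problem $$\min_{\xi\in\mathbb R^m}\ \phi(\xi):=\tfrac12\left\|\Pi_{\mathbb S^n_+}(\mathcal A^*\xi+Z)\right\|^2-\langle b,\xi\rangle,$$ where $\phi$ is convex and continuously differentiable with $\nabla\phi(\xi)=\mathcal A\,\Pi_{\mathbb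 S^n_+}(\mathcal A^*\xi+Z)-b$. Modified L-BFGS algorithm. Input: $\xi^0\in\mathbb R^m$, an integer $\mathtt{mem}>0$, a constant $K>0$, $\mu\in(0,1/2)$, $\rho\in(0,1)$, $\tau_1,\tau_2\in(0,\infty)$. For $k=0,1,2,\dots$: Step 1 (search direction): choose a symmetric positive definite $Q^0_k$ (the paper always takes $Q_k^0=I_m$), put $\beta_k:=\tau_1\|\nabla\phi(\xi^k)\|^{\tau_2}$, and compute $$d^k=-\beta_k\nabla\phi(\xi^k)-Q_k\nabla\phi(\xi^k),$$ where $Q_k\succeq0$ is the L-BFGS inverse-Hessian approximation given by the standard two-loop recursion: starting from $Q=Q_k^0$, for the stored pairs $(u^i,w^i)$ (from oldest to newest, at most $\mathtt{mem}$ most recent ones, those with $\langle u^i,w^i\rangle>0$), update $$Q\leftarrow\left(I-\frac{u^i(w^i)^{\mathsf T}}{\langle u^i,w^i\rangle}\right)Q\left(I-\frac{w^i(u^i)^{\mathsf T}}{\langle u^i,w^i\rangle}\right)+\frac{u^i(u^i)^{\mathsf T}}{\langle u^i,w^i\rangle},$$ and let $Q_k$ be the final $Q$. If $\|d^k\|\ge K$, then instead choose $d^k=-\beta_k\nabla\phi(\xi^k)$ (i.e. set $Q_k=0$). Step 2 (line search): set $\alpha_k=\rho^{m_k}$, where $m_k$ is the smallest nonnegative integer $m$ such that $$\phi(\xi^k+\rho^md^k)\le\phi(\xi^k)+\mu\rho^m\langle\nabla\phi(\xi^k),d^k\rangle,$$ and set $\xi^{k+1}=\xi^k+\alpha_kd^k$.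 Step 3 (memory): store $u^k=\xi^{k+1}-\xi^k$ and $w^k=\nabla\phi(\xi^{k+1})-\nabla\phi(\xi^k)$; if $k>\mathtt{mem}$, discard $(u^{k-\mathtt{mem}},w^{k-\mathtt{mem}})$. The algorithm's finite-tolerance stopping test is disregarded in the convergence statement (the sequence is infinite). *)

theory Defs
  imports "HOL-Analysis.Analysis"
begin

section \<open>Symmetric matrices\<close>

text \<open>
  The inner product \<open>(\<bullet>)\<close> and \<open>norm\<close> of \<^typ>\<open>real^'n^'n\<close> are entrywise; on symmetric
  matrices they are the trace inner product and the Frobenius norm.
\<close>

definition sym_mats :: "(real^'n^'n) set"
  where "sym_mats = {X. transpose X = X}"

definition psd_cone :: "(real^'n^'n) set"
  where "psd_cone = {X \<in> sym_mats. \<forall>v. 0 \<le> v \<bullet> (X *v v)}"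

definition pos_def :: "real^'n^'n \<Rightarrow> bool"
  where "pos_def X \<longleftrightarrow> X \<in> sym_mats \<and> (\<forall>v. v \<noteq> 0 \<longrightarrow> 0 < v \<bullet> (X *v v))"

text \<open>
  Operators out of the symmetric matrices are total functions on \<^typ>\<open>real^'n^'n\<close> of which
  only the values on \<^const>\<open>sym_mats\<close> are relevant.
\<close>

definition linear_on_sym :: "(real^'n^'n \<Rightarrow> real^'m) \<Rightarrow> bool"
  where "linear_on_sym A \<longleftrightarrow>
    (\<forall>X\<in>sym_mats. \<forall>Y\<in>sym_mats. A (X + Y) = A X + A Y) \<and>
    (\<forall>c. \<forall>X\<in>sym_mats. A (c *\<^sub>R X) = c *\<^sub>R A X)"

text \<open>
  The adjoint is taken with respect to the space of symmetric matrices, so its values are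
  symmetric; the library's \<^const>\<open>adjoint\<close> refers to the full matrix space instead.
\<close>

definition sym_adjoint :: "(real^'n^'n \<Rightarrow> real^'m) \<Rightarrow> real^'m \<Rightarrow> real^'n^'n"
  where "sym_adjoint A \<xi> = (THE Y. Y \<in> sym_mats \<and> (\<forall>X\<in>sym_mats. A X \<bullet> \<xi> = X \<bullet> Y))"

definition slater :: "(real^'n^'n \<Rightarrow> real^'m) \<Rightarrow> real^'m \<Rightarrow> bool"
  where "slater A b \<longleftrightarrow> (\<exists>X. A X = b \<and> pos_def X)"

definition dual_objective ::
    "(real^'n^'n \<Rightarrow> real^'m) \<Rightarrow> real^'m \<Rightarrow> real^'n^'n \<Rightarrow> real^'m \<Rightarrow> real"
  where "dual_objective A b Z \<xi> =
    1/2 * (norm (closest_point psd_cone (sym_adjoint A \<xi> + Z)))\<^sup>2 - b \<bullet> \<xi>"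

definition gradient :: "('a::real_inner \<Rightarrow> real) \<Rightarrow> 'a \<Rightarrow> 'a"
  where "gradient f x = (THE g. GDERIV f x :> g)"


section \<open>The modified L-BFGS algorithm\<close>

text \<open>
  \<open>\<xi> :: nat \<Rightarrow> real^'m\<close> is the sequence of iterates. Everything used in iteration \<open>k\<close> depends
  on \<open>\<xi> 0, \<dots>, \<xi> k\<close> only.
\<close>

definition step_diff :: "(nat \<Rightarrow> real^'m) \<Rightarrow> nat \<Rightarrow> real^'m"
  where "step_diff \<xi> i = \<xi> (Suc i) - \<xi> i"

definition grad_diff :: "(real^'m \<Rightarrow> real) \<Rightarrow> (nat \<Rightarrow> real^'m) \<Rightarrow> nat \<Rightarrow> real^'m"
  where "grad_diff f \<xi> i = gradient f (\<xi> (Suc i)) - gradient f (\<xi> i)"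

definition outer :: "real^'m \<Rightarrow> real^'m \<Rightarrow> real^'m^'m"
  where "outer u w = (\<chi> i j. u $ i * w $ j)"

definition bfgs_update :: "real^'m \<Rightarrow> real^'m \<Rightarrow> real^'m^'m \<Rightarrow> real^'m^'m"
  where "bfgs_update u w Q =
    (mat 1 - (1 / (u \<bullet> w)) *\<^sub>R outer u w) ** Q ** (mat 1 - (1 / (u \<bullet> w)) *\<^sub>R outer w u)
    + (1 / (u \<bullet> w)) *\<^sub>R outer u u"

text \<open>
  At iteration \<open>k\<close> the \<open>mem\<close> most recent pairs are those with index in
  \<open>[k - mem..<k]\<close>, listed from oldest to newest; the subtraction is truncated, so all pairs are
  used while \<open>k \<le> mem\<close>. Pairs without positive curvature are skipped, but still count towards
  the \<open>mem\<close> most recent ones. The discarding rule (drop the pair \<open>k - mem\<close> at the end of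
  iteration \<open>k > mem\<close>) never removes a pair of this window. The pair with index 0, which that
  rule never drops, is outside the window as soon as \<open>k > mem\<close>.
\<close>

definition lbfgs_matrix ::
    "(real^'m \<Rightarrow> real) \<Rightarrow> nat \<Rightarrow> real^'m^'m \<Rightarrow> (nat \<Rightarrow> real^'m) \<Rightarrow> nat \<Rightarrow> real^'m^'m"
  where "lbfgs_matrix f mem Q0 \<xi> k =
    foldl (\<lambda>Q i. bfgs_update (step_diff \<xi> i) (grad_diff f \<xi> i) Q) Q0
      (filter (\<lambda>i. step_diff \<xi> i \<bullet> grad_diff f \<xi> i > 0) [k - mem..<k])"

definition lbfgs_direction ::
    "(real^'m \<Rightarrow> real) \<Rightarrow> nat \<Rightarrow> real \<Rightarrow> real \<Rightarrow> real \<Rightarrow> (nat \<Rightarrow> real^'m^'m) \<Rightarrow>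
      (nat \<Rightarrow> real^'m) \<Rightarrow> nat \<Rightarrow> real^'m"
  where "lbfgs_direction f mem K \<tau>\<^sub>1 \<tau>\<^sub>2 Q0 \<xi> k =
    (let g = gradient f (\<xi> k);
         \<beta> = \<tau>\<^sub>1 * norm g powr \<tau>\<^sub>2;
         d = - \<beta> *\<^sub>R g - lbfgs_matrix f mem (Q0 k) \<xi> k *v g
     in if norm d \<ge> K then - \<beta> *\<^sub>R g else d)"

definition armijo ::
    "(real^'m \<Rightarrow> real) \<Rightarrow> real \<Rightarrow> real \<Rightarrow> real^'m \<Rightarrow> real^'m \<Rightarrow> nat \<Rightarrow> bool"
  where "armijo f \<mu> \<rho> x d j \<longleftrightarrow>
    f (x + \<rho> ^ j *\<^sub>R d) \<le> f x + \<mu> * \<rho> ^ j * (gradient f x \<bullet> d)"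

text \<open>\<open>\<xi> (Suc k)\<close> results from \<open>\<xi> 0, \<dots>, \<xi> k\<close> by iteration \<open>k\<close>, whose line search terminates.\<close>

definition lbfgs_step ::
    "(real^'m \<Rightarrow> real) \<Rightarrow> nat \<Rightarrow> real \<Rightarrow> real \<Rightarrow> real \<Rightarrow> real \<Rightarrow> real \<Rightarrow> (nat \<Rightarrow> real^'m^'m) \<Rightarrow>
      (nat \<Rightarrow> real^'m) \<Rightarrow> nat \<Rightarrow> bool"
  where "lbfgs_step f mem K \<mu> \<rho> \<tau>\<^sub>1 \<tau>\<^sub>2 Q0 \<xi> k \<longleftrightarrow>
    (let d = lbfgs_direction f mem K \<tau>\<^sub>1 \<tau>\<^sub>2 Q0 \<xi> k
     in \<exists>j. armijo f \<mu> \<rho> (\<xi> k) d j \<and> (\<forall>i<j. \<not> armijo f \<mu> \<rho> (\<xi> k) d i) \<and>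
            \<xi> (Suc k) = \<xi> k + \<rho> ^ j *\<^sub>R d)"


section \<open>The adjoint and the gradient exist\<close>

lemma transpose_plus: "transpose (X + Y) = transpose X + transpose (Y :: real^'n^'m)"
  by (simp add: transpose_def vec_eq_iff)

lemma inner_transpose: "transpose X \<bullet> transpose Y = X \<bullet> (Y :: real^'n^'m)"
  unfolding inner_vec_def transpose_def by (simp, rule sum.swap)

lemma sym_adjoint_ex1:
  fixes A :: "real^'n^'n \<Rightarrow> real^'m"
  assumes "linear_on_sym A"
  shows "\<exists>!Y. Y \<in> sym_mats \<and> (\<forall>X\<in>sym_mats. A X \<bullet> \<xi> = X \<bullet> Y)"
proof -
  let ?s = "\<lambda>X::real^'n^'n. (1/2) *\<^sub>R (X + transpose X)"
  have s: "?s X \<in> sym_mats" for X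
    by (simp add: sym_mats_def transpose_scalar transpose_plus add.commute)
  have s_id: "?s X = X" if "X \<in> sym_mats" for X
    using that by (simp add: sym_mats_def flip: scaleR_2)
  have s_inner: "X \<bullet> ?s Y = X \<bullet> Y" if "X \<in> sym_mats" for X Y
    using that inner_transpose[of X Y] by (simp add: sym_mats_def inner_add_right)
  have "linear (\<lambda>X. A (?s X))"
  proof (rule linearI)
    fix X Y
    have "?s (X + Y) = ?s X + ?s Y"
      by (simp add: transpose_plus algebra_simps)
    then show "A (?s (X + Y)) = A (?s X) + A (?s Y)"
      using assms s unfolding linear_on_sym_def by metis
  next
    fix c X
    have "?s (c *\<^sub>R X) = c *\<^sub>R ?s X"
      by (simp add: transpose_scalar algebra_simps)
    then show "A (?s (c *\<^sub>R X)) = c *\<^sub>R A (?s X)"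
      using assms s unfolding linear_on_sym_def by metis
  qed
  then have adj: "X \<bullet> adjoint (\<lambda>X. A (?s X)) \<xi> = A (?s X) \<bullet> \<xi>" for X
    by (rule adjoint_works)
  define W where "W = ?s (adjoint (\<lambda>X. A (?s X)) \<xi>)"
  have W_sym: "W \<in> sym_mats"
    unfolding W_def by (rule s)
  have W: "A X \<bullet> \<xi> = X \<bullet> W" if "X \<in> sym_mats" for X
    unfolding W_def s_inner[OF that] adj s_id[OF that] ..
  show ?thesis
  proof (rule ex1I)
    show "W \<in> sym_mats \<and> (\<forall>X\<in>sym_mats. A X \<bullet> \<xi> = X \<bullet> W)"
      using W_sym W by blast
  next
    fix Y assume Y: "Y \<in> sym_mats \<and> (\<forall>X\<in>sym_mats. A X \<bullet> \<xi> = X \<bullet> Y)"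
    have "Y \<bullet> (Y - W) = 0" "W \<bullet> (Y - W) = 0"
      using Y W W_sym by (simp_all add: inner_diff_right)
    then have "(Y - W) \<bullet> (Y - W) = 0"
      by (simp only: inner_diff_left)
    then show "Y = W" by simp
  qed
qed

lemma gradient_eqI:
  assumes "GDERIV f x :> g"
  shows "gradient f x = g"
  unfolding gradient_def
proof (rule the_equality)
  show "GDERIV f x :> g" by fact
next
  fix g' assume "GDERIV f x :> g'"
  then have "(\<lambda>h. h \<bullet> g') = (\<lambda>h. h \<bullet> g)"
    using assms has_derivative_unique unfolding gderiv_def by blast
  then show "g' = g" by (metis vector_eq_ldot)
qed

lemma sym_adjoint_in: "linear_on_sym A \<Longrightarrow> sym_adjoint A \<xi> \<in> sym_mats"
  and sym_adjoint_works: "linear_on_sym A \<Longrightarrow> X \<in> sym_mats \<Longrightarrow> A X \<bullet> \<xi> = X \<bullet> sym_adjoint A \<xi>"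
  using theI'[OF sym_adjoint_ex1[of A \<xi>]] unfolding sym_adjoint_def by auto

lemma sym_adjoint_eqI:
  assumes "linear_on_sym A" "Y \<in> sym_mats" "\<And>X. X \<in> sym_mats \<Longrightarrow> A X \<bullet> \<xi> = X \<bullet> Y"
  shows "sym_adjoint A \<xi> = Y"
  using sym_adjoint_ex1[OF assms(1), of \<xi>] sym_adjoint_in[OF assms(1)]
    sym_adjoint_works[OF assms(1)] assms(2,3) by blast

lemma linear_sym_adjoint:
  assumes "linear_on_sym A"
  shows "linear (sym_adjoint A)"
proof (rule linearI)
  fix \<xi> \<eta>
  show "sym_adjoint A (\<xi> + \<eta>) = sym_adjoint A \<xi> + sym_adjoint A \<eta>"
    using sym_adjoint_in[OF assms]
    by (intro sym_adjoint_eqI[OF assms])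
      (simp_all add: sym_mats_def transpose_plus sym_adjoint_works[OF assms] inner_add_right)
next
  fix c \<xi>
  show "sym_adjoint A (c *\<^sub>R \<xi>) = c *\<^sub>R sym_adjoint A \<xi>"
    using sym_adjoint_in[OF assms]
    by (intro sym_adjoint_eqI[OF assms])
      (simp_all add: sym_mats_def transpose_scalar sym_adjoint_works[OF assms])
qed

lemma zero_in_psd_cone: "0 \<in> psd_cone"
  by (simp add: psd_cone_def sym_mats_def transpose_def vec_eq_iff)

lemma psd_cone_scaleR: "X \<in> psd_cone \<Longrightarrow> 0 \<le> c \<Longrightarrow> c *\<^sub>R X \<in> psd_cone"
  by (simp add: psd_cone_def sym_mats_def transpose_scalar flip: scaleR_matrix_vector_assoc)

lemma psd_cone_add: "X \<in> psd_cone \<Longrightarrow> Y \<in> psd_cone \<Longrightarrow> X + Y \<in> psd_cone"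
  by (simp add: psd_cone_def sym_mats_def transpose_plus matrix_vector_mult_add_rdistrib
      inner_add_right)

lemma convex_psd_cone: "convex psd_cone"
  by (auto simp: convex_def intro: psd_cone_add psd_cone_scaleR)

lemma closed_psd_cone: "closed (psd_cone :: (real^'n^'n) set)"
proof -
  have "closed {X :: real^'n^'n. transpose X = X}"
    unfolding transpose_def by (intro closed_Collect_eq continuous_intros)
  moreover have "closed (\<Inter>v. {X :: real^'n^'n. 0 \<le> v \<bullet> (X *v v)})"
    unfolding matrix_vector_mult_def
    by (intro closed_INT ballI closed_Collect_le continuous_intros)
  ultimately have "closed ({X. transpose X = X} \<inter> (\<Inter>v. {X :: real^'n^'n. 0 \<le> v \<bullet> (X *v v)}))"
    by (rule closed_Int)
  also have "{X. transpose X = X} \<inter> (\<Inter>v. {X :: real^'n^'n. 0 \<le> v \<bullet> (X *v v)}) = psd_cone"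
    by (auto simp: psd_cone_def sym_mats_def)
  finally show ?thesis .
qed

lemma gderiv_half_norm_proj:
  fixes S :: "'a::euclidean_space set"
  assumes S: "closed S" "convex S" "0 \<in> S" and cone: "\<And>x c. x \<in> S \<Longrightarrow> 0 \<le> c \<Longrightarrow> c *\<^sub>R x \<in> S"
  shows "GDERIV (\<lambda>y. 1/2 * (norm (closest_point S y))\<^sup>2) y :> closest_point S y"
proof -
  let ?P = "closest_point S"
  let ?F = "\<lambda>y. 1/2 * (norm (?P y))\<^sup>2"
  have P: "?P y \<in> S" for y
    using S by (intro closest_point_in_set) auto
  have proj: "(y - ?P y) \<bullet> (x - ?P y) \<le> 0" if "x \<in> S" for x y
    using S that by (intro closest_point_dot)
  have ortho: "y \<bullet> ?P y = ?P y \<bullet> ?P y" for y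
    using proj[OF S(3), of y] proj[OF cone[OF P, of 2 y], of y]
    by (simp add: inner_diff_left inner_diff_right scaleR_2 inner_add_right)
  have lower: "x \<bullet> y - 1/2 * (x \<bullet> x) \<le> ?F y" if "x \<in> S" for x y
  proof -
    have "x \<bullet> y \<le> x \<bullet> ?P y"
      using proj[OF that, of y] ortho[of y]
      by (simp add: inner_diff_left inner_diff_right inner_commute)
    moreover have "0 \<le> (x - ?P y) \<bullet> (x - ?P y)" by simp
    ultimately show ?thesis
      unfolding power2_norm_eq_inner
      by (simp add: inner_diff_left inner_diff_right inner_commute)
  qed
  have eq: "?F y = ?P y \<bullet> y - 1/2 * (?P y \<bullet> ?P y)" for y
    unfolding power2_norm_eq_inner using ortho[of y] by (simp add: inner_commute)
  have bound: "\<bar>?F z - ?F y - (z - y) \<bullet> ?P y\<bar> \<le> norm (z - y) * norm (z - y)" for y z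
  proof -
    have "0 \<le> ?F z - ?F y - (z - y) \<bullet> ?P y"
      using lower[OF P[of y], of z] eq[of y]
      by (simp add: inner_diff_left inner_diff_right inner_commute diff_divide_distrib)
    moreover have "?F z - ?F y - (z - y) \<bullet> ?P y \<le> (z - y) \<bullet> (?P z - ?P y)"
      using lower[OF P[of z], of y] eq[of z]
      by (simp add: inner_diff_left inner_diff_right inner_commute diff_divide_distrib)
    moreover have "(z - y) \<bullet> (?P z - ?P y) \<le> norm (z - y) * norm (z - y)"
    proof (rule order_trans[OF norm_cauchy_schwarz mult_left_mono])
      show "norm (?P z - ?P y) \<le> norm (z - y)"
        using closest_point_lipschitz[of S z y] S by (auto simp: dist_norm)
    qed simp
    ultimately show ?thesis by linarith
  qed
  show ?thesis
    unfolding gderiv_def has_derivative_at_within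
  proof (intro conjI bounded_linear_inner_left)
    show "((\<lambda>z. ((?F z - ?F y) - (z - y) \<bullet> ?P y) /\<^sub>R norm (z - y)) \<longlongrightarrow> 0) (at y)"
    proof (rule Lim_null_comparison)
      show "\<forall>\<^sub>F z in at y. norm (((?F z - ?F y) - (z - y) \<bullet> ?P y) /\<^sub>R norm (z - y)) \<le> norm (z - y)"
        unfolding eventually_at_filter
      proof (rule always_eventually, intro allI impI)
        fix z assume "z \<noteq> y"
        then have "0 < norm (z - y)" by simp
        then show "norm (((?F z - ?F y) - (z - y) \<bullet> ?P y) /\<^sub>R norm (z - y)) \<le> norm (z - y)"
          using bound[of z y] by (simp add: divide_simps)
      qed
      show "((\<lambda>z. norm (z - y)) \<longlongrightarrow> 0) (at y)"
        by (intro tendsto_norm_zero LIM_zero tendsto_ident_at)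
    qed
  qed
qed

lemma gradient_dual_objective:
  assumes A: "linear_on_sym A"
  shows "GDERIV (dual_objective A b Z) \<xi> :> A (closest_point psd_cone (sym_adjoint A \<xi> + Z)) - b"
    and "gradient (dual_objective A b Z) \<xi> = A (closest_point psd_cone (sym_adjoint A \<xi> + Z)) - b"
proof -
  let ?P = "closest_point psd_cone (sym_adjoint A \<xi> + Z)"
  have "?P \<in> psd_cone"
    using zero_in_psd_cone by (intro closest_point_in_set closed_psd_cone) auto
  then have P: "?P \<in> sym_mats" by (simp add: psd_cone_def)
  have "(sym_adjoint A has_derivative sym_adjoint A) (at \<xi>)"
    by (intro linear_imp_has_derivative linear_sym_adjoint A)
  then have inner: "((\<lambda>\<xi>. sym_adjoint A \<xi> + Z) has_derivative sym_adjoint A) (at \<xi>)"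
    by (auto intro!: derivative_eq_intros)
  have "((\<lambda>\<xi>. 1/2 * (norm (closest_point psd_cone (sym_adjoint A \<xi> + Z)))\<^sup>2) has_derivative
      (\<lambda>h. sym_adjoint A h \<bullet> ?P)) (at \<xi>)"
    by (rule has_derivative_compose[OF inner gderiv_half_norm_proj[unfolded gderiv_def]])
      (simp_all add: closed_psd_cone convex_psd_cone zero_in_psd_cone psd_cone_scaleR)
  then have "((\<lambda>\<xi>. 1/2 * (norm (closest_point psd_cone (sym_adjoint A \<xi> + Z)))\<^sup>2 - b \<bullet> \<xi>)
      has_derivative (\<lambda>h. sym_adjoint A h \<bullet> ?P - b \<bullet> h)) (at \<xi>)"
    by (rule has_derivative_diff)
      (intro bounded_linear_imp_has_derivative bounded_linear_inner_right)
  moreover have "(\<lambda>h. sym_adjoint A h \<bullet> ?P - b \<bullet> h) = (\<lambda>h. h \<bullet> (A ?P - b))"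
    using sym_adjoint_works[OF A P] by (simp add: inner_diff_right inner_commute)
  ultimately show *: "GDERIV (dual_objective A b Z) \<xi> :> A ?P - b"
    unfolding gderiv_def dual_objective_def by simp
  show "gradient (dual_objective A b Z) \<xi> = A ?P - b"
    by (rule gradient_eqI[OF *])
qed

end

(* By Slater, phi(xi) >= c |xi| - m: with W = A^* xi + Z and P its projection, P - W lies in the
   dual cone, against which a positive definite X grows linearly, and b . xi = <X, A^* xi>.
   The gradient of phi is Lipschitz, so the line search accepts a step bounded below in terms of
   <grad, d> and |d|. The beta-term alone gives <grad, d> <= -tau1 |grad|^(2 + tau2), since the L-BFGS
   matrix is positive semidefinite, and the cutoff K controls |d|. Hence phi would decrease by a
   fixed amount infinitely often near an accumulation point that is not critical. *)
theory Submission
  imports Defs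
begin

section \<open>First-order inequalities for differentiable functions\<close>

text \<open>One-dimensional mean value theorem for the restriction of \<open>f\<close> to the
  segment from \<open>x\<close> to \<open>x + h\<close>.\<close>

lemma GDERIV_mvt:
  assumes "\<And>x. GDERIV f x :> g x"
  obtains t where "0 < t" "t < 1" "f (x + h) - f x = g (x + t *\<^sub>R h) \<bullet> h"
proof -
  have "DERIV (\<lambda>t. f (x + t *\<^sub>R h)) t :> g (x + t *\<^sub>R h) \<bullet> h" for t
  proof -
    have "((\<lambda>t. x + t *\<^sub>R h) has_derivative (\<lambda>t. t *\<^sub>R h)) (at t)"
      by (auto intro!: derivative_eq_intros)
    from has_derivative_compose[OF this assms[unfolded gderiv_def]]
    show ?thesis
      by (simp add: has_field_derivative_def inner_commute mult_commute_abs)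
  qed
  from MVT2[OF zero_less_one this] show ?thesis
    using that by auto
qed

text \<open>Convexity in first-order form: by monotonicity, the slope along \<open>h\<close> at the
  mean value point is at least the slope at \<open>x\<close>. It later turns critical points into
  global minimizers.\<close>

lemma monotone_gradient_lower_bound:
  assumes "\<And>x. GDERIV f x :> g x" and mono: "\<And>x y. 0 \<le> (g y - g x) \<bullet> (y - x)"
  shows "f x + g x \<bullet> h \<le> f (x + h)"
proof -
  obtain t where t: "0 < t" "f (x + h) - f x = g (x + t *\<^sub>R h) \<bullet> h"
    using GDERIV_mvt[OF assms(1)] by blast
  have "0 \<le> (g (x + t *\<^sub>R h) - g x) \<bullet> h"
    using mono[of "x + t *\<^sub>R h" x] t(1) by (simp add: zero_le_mult_iff)
  then show ?thesis
    using t(2) by (simp add: inner_diff_left)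
qed

text \<open>The descent lemma. The mean value theorem, used instead of an integral, gives the
  constant \<open>L\<close> rather than \<open>L / 2\<close>; any fixed constant serves the line
  search.\<close>

lemma lipschitz_gradient_upper_bound:
  assumes "\<And>x. GDERIV f x :> g x" and lip: "\<And>x y. norm (g y - g x) \<le> L * norm (y - x)"
  shows "f (x + h) \<le> f x + g x \<bullet> h + L * (norm h)\<^sup>2"
proof -
  obtain t where t: "0 < t" "t < 1" "f (x + h) - f x = g (x + t *\<^sub>R h) \<bullet> h"
    using GDERIV_mvt[OF assms(1)] by blast
  \<comment> \<open>The sign is read off from the Lipschitz bound; it is what allows
    \<open>t\<close> to be replaced by 1 below.\<close>
  have "0 \<le> L * norm h"
    using order_trans[OF norm_ge_zero lip[of "x + h" x]] by simp
  have "(g (x + t *\<^sub>R h) - g x) \<bullet> h \<le> norm (g (x + t *\<^sub>R h) - g x) * norm h"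
    by (rule norm_cauchy_schwarz)
  also have "\<dots> \<le> (L * (t * norm h)) * norm h"
    using lip[of "x + t *\<^sub>R h" x] t(1) by (intro mult_right_mono) auto
  also have "\<dots> = t * (L * norm h * norm h)"
    by simp
  also have "\<dots> \<le> 1 * (L * norm h * norm h)"
    using t \<open>0 \<le> L * norm h\<close> by (intro mult_right_mono) auto
  finally show ?thesis
    using t(3) by (simp add: inner_diff_left power2_eq_square)
qed

section \<open>Projections and the dual of the semidefinite cone\<close>

text \<open>Adding the variational inequalities of the two projections bounds the inner product
  below by the squared distance between them.\<close>

lemma closest_point_monotone:
  fixes S :: "'a::euclidean_space set"
  assumes "convex S" "closed S" "S \<noteq> {}"
  shows "0 \<le> (closest_point S y - closest_point S x) \<bullet> (y - x)"
proof -
  let ?P = "closest_point S"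
  have "(x - ?P x) \<bullet> (?P y - ?P x) \<le> 0" "(y - ?P y) \<bullet> (?P x - ?P y) \<le> 0"
    using assms by (auto intro!: closest_point_dot closest_point_in_set)
  moreover have "0 \<le> (?P y - ?P x) \<bullet> (?P y - ?P x)"
    by simp
  ultimately show ?thesis
    by (simp add: inner_diff_left inner_diff_right inner_commute)
qed

text \<open>Cauchy-Schwarz in each row; \<open>norm H\<close> is the Frobenius norm.\<close>

lemma norm_matrix_vector_mult_le:
  fixes H :: "real^'n^'m"
  shows "norm (H *v v) \<le> norm H * norm v"
proof -
  have "norm (H *v v) = L2_set (\<lambda>i. norm ((H *v v) $ i)) UNIV"
    by (simp add: norm_vec_def)
  also have "\<dots> \<le> L2_set (\<lambda>i. norm (H $ i) * norm v) UNIV"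
  proof (rule L2_set_mono)
    fix i
    have "(H *v v) $ i = H $ i \<bullet> v"
      by (simp add: matrix_vector_mult_def inner_vec_def)
    then show "norm ((H *v v) $ i) \<le> norm (H $ i) * norm v"
      by (simp add: Cauchy_Schwarz_ineq2)
  qed simp
  also have "\<dots> = norm H * norm v"
    by (simp add: L2_set_left_distrib norm_vec_def[of H])
  finally show ?thesis .
qed

text \<open>\<open>c\<close> is the minimum of the quadratic form on the compact unit sphere;
  homogeneity extends the bound to all \<open>v\<close>.\<close>

lemma pos_def_lower_bound:
  fixes X :: "real^'n^'n"
  assumes "pos_def X"
  obtains c where "0 < c" "\<And>v. c * (norm v)\<^sup>2 \<le> v \<bullet> (X *v v)"
proof -
  have "continuous_on (sphere 0 1) (\<lambda>v. v \<bullet> (X *v v))"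
    by (intro continuous_intros matrix_vector_mult_linear_continuous_on)
  moreover have "sphere (0::real^'n) 1 \<noteq> {}"
    by simp
  ultimately obtain u where "u \<in> sphere 0 1"
      and min: "\<And>v. v \<in> sphere 0 1 \<Longrightarrow> u \<bullet> (X *v u) \<le> v \<bullet> (X *v v)"
    using continuous_attains_inf[OF compact_sphere] by blast
  then have "u \<noteq> 0"
    by auto
  show ?thesis
  proof
    show "0 < u \<bullet> (X *v u)"
      using assms \<open>u \<noteq> 0\<close> by (simp add: pos_def_def)
    show "u \<bullet> (X *v u) * (norm v)\<^sup>2 \<le> v \<bullet> (X *v v)" for v
    proof (cases "v = 0")
      case False
      have "u \<bullet> (X *v u) \<le> (v /\<^sub>R norm v) \<bullet> (X *v (v /\<^sub>R norm v))"
        using False by (intro min) simp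
      also have "\<dots> = (v \<bullet> (X *v v)) / (norm v)\<^sup>2"
        unfolding matrix_vector_mult_scaleR inner_scaleR_left inner_scaleR_right
        using False by (simp add: field_simps power2_eq_square)
      finally show ?thesis
        using False by (simp add: pos_le_divide_eq)
    qed simp
  qed
qed

text \<open>\<open>X\<close> is interior to the cone: moving from it by Frobenius distance
  \<open>c\<close> in the direction \<open>- Y\<close> stays inside. Testing \<open>Y\<close>
  against the point so reached gives the linear growth.\<close>

lemma pos_def_inner_dual_cone:
  fixes X :: "real^'n^'n"
  assumes "pos_def X"
  obtains c where "0 < c"
    "\<And>Y. Y \<in> sym_mats \<Longrightarrow> (\<And>V. V \<in> psd_cone \<Longrightarrow> 0 \<le> V \<bullet> Y) \<Longrightarrow> c * norm Y \<le> X \<bullet> Y"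
proof -
  obtain c where c: "0 < c" "\<And>v. c * (norm v)\<^sup>2 \<le> v \<bullet> (X *v v)"
    using pos_def_lower_bound[OF assms] by blast
  have "c * norm Y \<le> X \<bullet> Y"
    if Y: "Y \<in> sym_mats" and dual: "\<And>V. V \<in> psd_cone \<Longrightarrow> 0 \<le> V \<bullet> Y" for Y
  proof (cases "Y = 0")
    case False
    let ?V = "X - (c / norm Y) *\<^sub>R Y"
    have "?V \<in> psd_cone"
    proof -
      have "transpose ?V = ?V"
        using assms Y by (simp add: pos_def_def sym_mats_def transpose_def vec_eq_iff)
      moreover have "0 \<le> v \<bullet> (?V *v v)" for v
      proof -
        have "v \<bullet> (Y *v v) \<le> norm v * (norm Y * norm v)"
          using norm_cauchy_schwarz norm_matrix_vector_mult_le
          by (meson mult_left_mono norm_ge_zero order_trans)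
        then have "(c / norm Y) * (v \<bullet> (Y *v v)) \<le> (c / norm Y) * (norm v * (norm Y * norm v))"
          using c(1) by (intro mult_left_mono) auto
        also have "\<dots> = c * (norm v)\<^sup>2"
          using False by (simp add: power2_eq_square)
        finally show ?thesis
          using c(2)[of v]
          by (simp add: matrix_vector_mult_diff_rdistrib inner_diff_right
              flip: scaleR_matrix_vector_assoc)
      qed
      ultimately show ?thesis
        by (simp add: psd_cone_def sym_mats_def)
    qed
    from dual[OF this] show ?thesis
      using False by (simp add: inner_diff_left dot_square_norm power2_eq_square)
  qed simp
  with c(1) show ?thesis
    using that by blast
qed

section \<open>Coercivity of the dual objective\<close>

lemma psd_cone_nonempty: "psd_cone \<noteq> {}"
  using zero_in_psd_cone by blast

text \<open>Serves twice: it bounds the sublevel sets, hence the iterates, and it bounds the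
  objective from below. Injectivity of the adjoint converts growth in the matrix space into growth
  in \<open>\<xi>\<close>.\<close>

lemma dual_objective_coercive:
  fixes A :: "real^'n^'n \<Rightarrow> real^'m"
  assumes A: "linear_on_sym A" and Z: "Z \<in> sym_mats" and inj: "inj (sym_adjoint A)"
    and "slater A b"
  obtains c m where "0 < c" "\<And>\<xi>. c * norm \<xi> - m \<le> dual_objective A b Z \<xi>"
proof -
  obtain X where X: "A X = b" "pos_def X"
    using \<open>slater A b\<close> by (auto simp: slater_def)
  obtain c where c: "0 < c"
      "\<And>Y. Y \<in> sym_mats \<Longrightarrow> (\<And>V. V \<in> psd_cone \<Longrightarrow> 0 \<le> V \<bullet> Y) \<Longrightarrow> c * norm Y \<le> X \<bullet> Y"
    using pos_def_inner_dual_cone[OF X(2)] by blast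
  obtain B where B: "0 < B" "\<And>\<xi>. B * norm \<xi> \<le> norm (sym_adjoint A \<xi>)"
    using linear_inj_bounded_below_pos[OF linear_sym_adjoint[OF A] inj] by (metis mult.commute)
  \<comment> \<open>A common slope for \<open>norm P\<close>, available with slope 1, and
    \<open>norm (P - W)\<close>, available with slope \<open>c\<close>.\<close>
  define e where "e = min c 1"
  define m where "m = e * norm Z + (norm X + 1)\<^sup>2 / 2 - X \<bullet> Z"
  have "e * B * norm \<xi> - m \<le> dual_objective A b Z \<xi>" for \<xi>
  proof -
    define W where "W = sym_adjoint A \<xi> + Z"
    define P where "P = closest_point psd_cone W"
    have P: "P \<in> psd_cone"
      unfolding P_def by (intro closest_point_in_set closed_psd_cone psd_cone_nonempty)
    have proj: "(W - P) \<bullet> (V - P) \<le> 0" if "V \<in> psd_cone" for V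
      unfolding P_def using that by (intro closest_point_dot convex_psd_cone closed_psd_cone)
    \<comment> \<open>The projection inequality is tested at \<open>P + V\<close>, which lies in the
      cone.\<close>
    have "0 \<le> V \<bullet> (P - W)" if "V \<in> psd_cone" for V
      using proj[OF psd_cone_add[OF P that]] by (simp add: algebra_simps inner_commute)
    moreover have "P - W \<in> sym_mats"
      using P Z sym_adjoint_in[OF A, of \<xi>]
      by (simp add: W_def psd_cone_def sym_mats_def transpose_def vec_eq_iff)
    ultimately have dual: "c * norm (P - W) \<le> X \<bullet> (P - W)"
      by (intro c(2))
    have "X \<bullet> P \<le> norm X * norm P"
      by (rule norm_cauchy_schwarz)
    \<comment> \<open>Completing the square at \<open>norm X + 1\<close> instead of
      \<open>norm X\<close> leaves a linear term \<open>norm P\<close> over.\<close>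
    have quad: "norm P - (norm X + 1)\<^sup>2 / 2 \<le> 1/2 * (norm P)\<^sup>2 - norm X * norm P"
      using zero_le_power2[of "norm P - (norm X + 1)"]
      by (simp add: power2_eq_square field_simps)
    have "b \<bullet> \<xi> = X \<bullet> W - X \<bullet> Z"
      using sym_adjoint_works[OF A, of X \<xi>] X
      by (simp add: W_def inner_add_right pos_def_def)
    then have "dual_objective A b Z \<xi> = 1/2 * (norm P)\<^sup>2 - X \<bullet> P + X \<bullet> (P - W) + X \<bullet> Z"
      by (simp add: dual_objective_def flip: W_def P_def add: inner_diff_right)
    with dual quad \<open>X \<bullet> P \<le> _\<close>
    have "norm P + c * norm (P - W) - (norm X + 1)\<^sup>2 / 2 + X \<bullet> Z \<le> dual_objective A b Z \<xi>"
      by linarith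
    moreover have "e * (norm P + norm (P - W)) \<le> norm P + c * norm (P - W)"
      unfolding e_def distrib_left
      using mult_right_mono[of "min c 1" 1 "norm P"] by (intro add_mono mult_right_mono) auto
    moreover have "e * (B * norm \<xi>) \<le> e * (norm P + norm (P - W) + norm Z)"
    proof (rule mult_left_mono)
      have "sym_adjoint A \<xi> = P - (P - W) - Z"
        by (simp add: W_def)
      then have "norm (sym_adjoint A \<xi>) \<le> norm P + norm (P - W) + norm Z"
        using norm_triangle_ineq4[of "P - (P - W)" Z] norm_triangle_ineq4[of P "P - W"]
        by simp
      then show "B * norm \<xi> \<le> norm P + norm (P - W) + norm Z"
        using B(2)[of \<xi>] by linarith
      show "0 \<le> e"
        using c(1) by (simp add: e_def)
    qed
    ultimately show ?thesis
      unfolding m_def by (simp add: algebra_simps)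
  qed
  moreover have "0 < e * B"
    using B(1) c(1) by (simp add: e_def)
  ultimately show ?thesis
    using that by blast
qed

section \<open>Monotonicity and Lipschitz continuity of the gradient\<close>

text \<open>The constant \<open>b\<close> cancels and the adjoint moves \<open>A\<close> to the
  other side, so properties of the projection transfer to the gradient.\<close>

lemma gradient_dual_objective_inner:
  fixes A :: "real^'n^'n \<Rightarrow> real^'m"
  assumes A: "linear_on_sym A"
  shows "(gradient (dual_objective A b Z) y - gradient (dual_objective A b Z) x) \<bullet> h =
    (closest_point psd_cone (sym_adjoint A y + Z) - closest_point psd_cone (sym_adjoint A x + Z))
      \<bullet> sym_adjoint A h"
proof -
  \<comment> \<open>The adjoint identity is available on \<open>sym_mats\<close>, so the projections
    have to be placed there.\<close>
  have "closest_point psd_cone W \<in> sym_mats" for W :: "real^'n^'n"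
    using closest_point_in_set[OF closed_psd_cone psd_cone_nonempty, of W]
    unfolding psd_cone_def by blast
  then show ?thesis
    by (simp add: gradient_dual_objective[OF A] inner_diff_left sym_adjoint_works[OF A])
qed

lemma gradient_dual_objective_monotone:
  assumes "linear_on_sym A"
  shows "0 \<le> (gradient (dual_objective A b Z) y - gradient (dual_objective A b Z) x) \<bullet> (y - x)"
proof -
  have "sym_adjoint A (y - x) = (sym_adjoint A y + Z) - (sym_adjoint A x + Z)"
    by (simp add: linear_diff[OF linear_sym_adjoint[OF assms]])
  then show ?thesis
    unfolding gradient_dual_objective_inner[OF assms]
    using closest_point_monotone[OF convex_psd_cone closed_psd_cone psd_cone_nonempty] by metis
qed

text \<open>The projection is nonexpansive and the adjoint enters twice, so \<open>L = B * B\<close>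
  for a bound \<open>B\<close> of the adjoint. The gradient difference is tested against itself and
  one factor of its norm is cancelled.\<close>

lemma gradient_dual_objective_lipschitz:
  assumes A: "linear_on_sym A"
  obtains L where "0 < L"
    "\<And>x y. norm (gradient (dual_objective A b Z) y - gradient (dual_objective A b Z) x)
      \<le> L * norm (y - x)"
proof -
  let ?g = "gradient (dual_objective A b Z)"
  obtain B where B: "0 < B" "\<And>\<xi>. norm (sym_adjoint A \<xi>) \<le> B * norm \<xi>"
    using linear_bounded_pos[OF linear_sym_adjoint[OF A]] by blast
  have "norm (?g y - ?g x) \<le> B * B * norm (y - x)" for x y
  proof (cases "?g y = ?g x")
    case False
    let ?h = "?g y - ?g x"
    let ?D = "closest_point psd_cone (sym_adjoint A y + Z)
      - closest_point psd_cone (sym_adjoint A x + Z)"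
    have "norm ?D \<le> norm ((sym_adjoint A y + Z) - (sym_adjoint A x + Z))"
      using closest_point_lipschitz[OF convex_psd_cone closed_psd_cone psd_cone_nonempty]
      unfolding dist_norm .
    also have "\<dots> = norm (sym_adjoint A (y - x))"
      by (simp add: linear_diff[OF linear_sym_adjoint[OF A]])
    also have "\<dots> \<le> B * norm (y - x)"
      by (rule B(2))
    finally have D: "norm ?D \<le> B * norm (y - x)" .
    have "norm ?h * norm ?h = ?h \<bullet> ?h"
      by (simp add: dot_square_norm power2_eq_square)
    also have "\<dots> \<le> norm ?D * norm (sym_adjoint A ?h)"
      unfolding gradient_dual_objective_inner[OF A] by (rule norm_cauchy_schwarz)
    also have "\<dots> \<le> (B * norm (y - x)) * (B * norm ?h)"
      using B(1) by (intro mult_mono D B(2)) auto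
    finally have "norm ?h * norm ?h \<le> (B * B * norm (y - x)) * norm ?h"
      by (simp add: algebra_simps)
    then show ?thesis
      using False by (simp add: mult_le_cancel_right)
  qed (use B(1) in simp)
  then show ?thesis
    using that B(1) by (meson mult_pos_pos)
qed

section \<open>The L-BFGS matrix and the search direction\<close>

lemma outer_mult_vector: "outer u w *v v = (w \<bullet> v) *\<^sub>R u"
proof -
  have "(\<Sum>j\<in>UNIV. u $ i * w $ j * v $ j) = (\<Sum>j\<in>UNIV. w $ j * v $ j) * u $ i" for i
    unfolding sum_distrib_right by (simp only: mult_ac)
  then show ?thesis
    by (simp add: outer_def matrix_vector_mult_def vec_eq_iff inner_vec_def)
qed

text \<open>The update is a congruence of \<open>Q\<close> plus a positive multiple of a rank-one
  square.\<close>

lemma bfgs_update_nonneg: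
  assumes Q: "\<And>v. 0 \<le> v \<bullet> (Q *v v)" and "0 < u \<bullet> w"
  shows "0 \<le> v \<bullet> (bfgs_update u w Q *v v)"
proof -
  let ?c = "1 / (u \<bullet> w)"
  let ?v = "v - (?c * (u \<bullet> v)) *\<^sub>R w"
  have right: "(mat 1 - ?c *\<^sub>R outer w u) *v v = ?v"
    by (simp add: matrix_vector_mult_diff_rdistrib outer_mult_vector
        flip: scaleR_matrix_vector_assoc)
  \<comment> \<open>The left factor is the transpose of the right one, so it moves onto
    \<open>v\<close> and yields the same \<open>?v\<close>.\<close>
  have left: "v \<bullet> ((mat 1 - ?c *\<^sub>R outer u w) *v x) = ?v \<bullet> x" for x
    by (simp add: matrix_vector_mult_diff_rdistrib outer_mult_vector inner_diff_left
        inner_diff_right inner_commute flip: scaleR_matrix_vector_assoc)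
  have "v \<bullet> (bfgs_update u w Q *v v) = ?v \<bullet> (Q *v ?v) + ?c * (u \<bullet> v)\<^sup>2"
    unfolding bfgs_update_def matrix_vector_mult_add_rdistrib inner_add_right
      matrix_vector_mul_assoc[symmetric] left right
    by (simp add: outer_mult_vector inner_commute power2_eq_square
        flip: scaleR_matrix_vector_assoc)
  also have "\<dots> \<ge> 0"
    using Q[of ?v] assms(2) by simp
  finally show ?thesis .
qed

lemma lbfgs_matrix_nonneg:
  assumes "pos_def Q"
  shows "0 \<le> v \<bullet> (lbfgs_matrix f mem Q \<xi> k *v v)"
proof -
  have "0 \<le> v \<bullet> (foldl (\<lambda>Q i. bfgs_update (step_diff \<xi> i) (grad_diff f \<xi> i) Q) Q
      (filter (\<lambda>i. step_diff \<xi> i \<bullet> grad_diff f \<xi> i > 0) is) *v v)" for "is"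
  \<comment> \<open>For an arbitrary index list, taken from the right since \<open>foldl\<close>
    applies the newest pair last; the filter supplies the positive curvature.\<close>
  proof (induction "is" arbitrary: v rule: rev_induct)
    case Nil
    show ?case
      using assms by (cases "v = 0") (auto simp: pos_def_def intro: less_imp_le)
  next
    case (snoc i "is")
    then show ?case
      by (auto intro!: bfgs_update_nonneg)
  qed
  then show ?thesis
    unfolding lbfgs_matrix_def .
qed

text \<open>The \<open>\<beta>\<close> term alone produces the left side, and the positive
  semidefinite L-BFGS term can only add to the descent.\<close>

lemma lbfgs_direction_descent:
  fixes f :: "real^'m \<Rightarrow> real"
  assumes "pos_def (Q0 k)"
  shows "\<tau>\<^sub>1 * norm (gradient f (\<xi> k)) powr \<tau>\<^sub>2 * (norm (gradient f (\<xi> k)))\<^sup>2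
    \<le> - (gradient f (\<xi> k) \<bullet> lbfgs_direction f mem K \<tau>\<^sub>1 \<tau>\<^sub>2 Q0 \<xi> k)"
proof -
  let ?g = "gradient f (\<xi> k)" and ?Q = "lbfgs_matrix f mem (Q0 k) \<xi> k"
  let ?\<beta> = "\<tau>\<^sub>1 * norm ?g powr \<tau>\<^sub>2"
  have "0 \<le> ?g \<bullet> (?Q *v ?g)"
    by (rule lbfgs_matrix_nonneg[OF assms])
  \<comment> \<open>With an arbitrary \<open>d\<close> in the cutoff test, a case split settles both
    branches; the fallback branch gives equality.\<close>
  then have "?\<beta> * (norm ?g)\<^sup>2 \<le> - (?g \<bullet> (if norm d \<ge> K then - ?\<beta> *\<^sub>R ?g
      else - ?\<beta> *\<^sub>R ?g - ?Q *v ?g))" for d :: "real^'m"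
    by (simp add: inner_diff_right power2_norm_eq_inner)
  then show ?thesis
    unfolding lbfgs_direction_def Let_def .
qed

text \<open>A direction that passes the cutoff is shorter than \<open>K\<close>; the other term of
  the maximum is the length of the fallback.\<close>

lemma norm_lbfgs_direction_le:
  assumes "0 < \<tau>\<^sub>1"
  shows "norm (lbfgs_direction f mem K \<tau>\<^sub>1 \<tau>\<^sub>2 Q0 \<xi> k)
    \<le> max K (\<tau>\<^sub>1 * norm (gradient f (\<xi> k)) powr \<tau>\<^sub>2 * norm (gradient f (\<xi> k)))"
  using assms by (auto simp: lbfgs_direction_def Let_def)

section \<open>The Armijo line search\<close>

text \<open>The Armijo test gives away the share \<open>1 - \<mu>\<close> of the linear decrease; a
  short step lets this share absorb the quadratic error.\<close>

lemma armijo_small_step: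
  assumes up: "\<And>x h. f (x + h) \<le> f x + gradient f x \<bullet> h + L * (norm h)\<^sup>2"
    and "0 < \<rho>" and small: "\<rho> ^ j * (L * (norm d)\<^sup>2) \<le> (1 - \<mu>) * - (gradient f x \<bullet> d)"
  shows "armijo f \<mu> \<rho> x d j"
proof -
  have "f (x + \<rho> ^ j *\<^sub>R d) \<le> f x + \<rho> ^ j * (gradient f x \<bullet> d) + \<rho> ^ j * (\<rho> ^ j * (L * (norm d)\<^sup>2))"
    using up[of x "\<rho> ^ j *\<^sub>R d"]
    by (simp add: power_mult_distrib power2_eq_square mult.left_commute mult.assoc)
  moreover have "\<rho> ^ j * (\<rho> ^ j * (L * (norm d)\<^sup>2)) \<le> \<rho> ^ j * ((1 - \<mu>) * - (gradient f x \<bullet> d))"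
    using small \<open>0 < \<rho>\<close> by (intro mult_left_mono) auto
  ultimately show ?thesis
    unfolding armijo_def by (simp add: algebra_simps)
qed

text \<open>The left side of the smallness condition in \<open>armijo_small_step\<close> tends to 0,
  while descent keeps its right side positive.\<close>

lemma armijo_terminates:
  assumes up: "\<And>x h. f (x + h) \<le> f x + gradient f x \<bullet> h + L * (norm h)\<^sup>2"
    and "0 < \<rho>" "\<rho> < 1" "\<mu> < 1" and "gradient f x \<bullet> d < 0"
  shows "\<exists>j. armijo f \<mu> \<rho> x d j"
proof -
  have "(\<lambda>j. \<rho> ^ j * (L * (norm d)\<^sup>2)) \<longlonglongrightarrow> 0 * (L * (norm d)\<^sup>2)"
    using assms by (intro tendsto_intros LIMSEQ_power_zero) auto
  moreover have "0 * (L * (norm d)\<^sup>2) < (1 - \<mu>) * - (gradient f x \<bullet> d)"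
    using assms by (simp add: mult_pos_neg)
  ultimately have "\<forall>\<^sub>F j in sequentially. \<rho> ^ j * (L * (norm d)\<^sup>2) < (1 - \<mu>) * - (gradient f x \<bullet> d)"
    by (rule order_tendstoD(2))
  then show ?thesis
    using armijo_small_step[of f L \<rho>, OF up \<open>0 < \<rho>\<close>] unfolding eventually_sequentially
    by (meson less_imp_le order_refl)
qed

text \<open>\<open>\<delta>\<close> and \<open>D\<close> stand for bounds on slope and length, so
  that the guaranteed decrease can be made independent of \<open>k\<close>.\<close>

lemma lbfgs_step_decrease:
  fixes f :: "real^'m \<Rightarrow> real"
  assumes up: "\<And>x h. f (x + h) \<le> f x + gradient f x \<bullet> h + L * (norm h)\<^sup>2"
    and L: "0 < L" and \<mu>: "0 < \<mu>" "\<mu> < 1" and \<rho>: "0 < \<rho>" "\<rho> < 1"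
    and step: "lbfgs_step f mem K \<mu> \<rho> \<tau>\<^sub>1 \<tau>\<^sub>2 Q0 \<xi> k"
    and \<delta>: "0 \<le> \<delta>" "\<delta> \<le> - (gradient f (\<xi> k) \<bullet> lbfgs_direction f mem K \<tau>\<^sub>1 \<tau>\<^sub>2 Q0 \<xi> k)"
    and D: "0 < D" "norm (lbfgs_direction f mem K \<tau>\<^sub>1 \<tau>\<^sub>2 Q0 \<xi> k) \<le> D"
  shows "f (\<xi> (Suc k)) \<le> f (\<xi> k) - \<mu> * min 1 (\<rho> * (1 - \<mu>) * \<delta> / (L * D\<^sup>2)) * \<delta>"
proof -
  define d where "d = lbfgs_direction f mem K \<tau>\<^sub>1 \<tau>\<^sub>2 Q0 \<xi> k"
  obtain j where j: "armijo f \<mu> \<rho> (\<xi> k) d j" "\<And>i. i < j \<Longrightarrow> \<not> armijo f \<mu> \<rho> (\<xi> k) d i"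
      "\<xi> (Suc k) = \<xi> k + \<rho> ^ j *\<^sub>R d"
    using step unfolding lbfgs_step_def Let_def d_def by blast
  have "min 1 (\<rho> * (1 - \<mu>) * \<delta> / (L * D\<^sup>2)) \<le> \<rho> ^ j"
  proof (cases j)
    \<comment> \<open>The trial \<open>i = j - 1\<close> was rejected, so the smallness condition
      fails there; one factor \<open>\<rho>\<close> leads from \<open>i\<close> to \<open>j\<close>.
      For \<open>j = 0\<close> the full step accounts for the 1 in the minimum.\<close>
    case (Suc i)
    have "(1 - \<mu>) * \<delta> \<le> (1 - \<mu>) * - (gradient f (\<xi> k) \<bullet> d)"
      using \<mu> \<delta> by (intro mult_left_mono) (auto simp: d_def)
    also have "\<dots> < \<rho> ^ i * (L * (norm d)\<^sup>2)"
      using armijo_small_step[of f L \<rho> i d \<mu> "\<xi> k", OF up \<rho>(1)] j(2)[of i] Suc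
      by (intro not_le_imp_less) auto
    also have "\<dots> \<le> \<rho> ^ i * (L * D\<^sup>2)"
      using L \<rho> D by (intro mult_left_mono power_mono) (auto simp: d_def)
    finally have "\<rho> * ((1 - \<mu>) * \<delta>) \<le> \<rho> * (\<rho> ^ i * (L * D\<^sup>2))"
      using \<rho> by (intro mult_left_mono) auto
    then have "\<rho> * (1 - \<mu>) * \<delta> / (L * D\<^sup>2) \<le> \<rho> ^ j"
      using L D Suc by (simp add: pos_divide_le_eq mult.assoc)
    then show ?thesis
      by simp
  qed simp
  then have "min 1 (\<rho> * (1 - \<mu>) * \<delta> / (L * D\<^sup>2)) * \<delta> \<le> \<rho> ^ j * - (gradient f (\<xi> k) \<bullet> d)"
    using \<delta> \<rho> by (intro mult_mono) (auto simp: d_def)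
  then have "\<mu> * (min 1 (\<rho> * (1 - \<mu>) * \<delta> / (L * D\<^sup>2)) * \<delta>)
      \<le> \<mu> * (\<rho> ^ j * - (gradient f (\<xi> k) \<bullet> d))"
    using \<mu> by (intro mult_left_mono) auto
  then show ?thesis
    using j(1) unfolding armijo_def j(3) by (simp add: mult.assoc)
qed

lemma lbfgs_decseq:
  fixes f :: "real^'m \<Rightarrow> real"
  assumes "0 < \<mu>" "0 < \<rho>" "0 < \<tau>\<^sub>1" "\<And>k. pos_def (Q0 k)"
    and step: "\<And>k. lbfgs_step f mem K \<mu> \<rho> \<tau>\<^sub>1 \<tau>\<^sub>2 Q0 \<xi> k"
  shows "decseq (\<lambda>k. f (\<xi> k))"
proof (rule decseq_SucI)
  fix k
  let ?d = "lbfgs_direction f mem K \<tau>\<^sub>1 \<tau>\<^sub>2 Q0 \<xi> k"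
  obtain j where j: "armijo f \<mu> \<rho> (\<xi> k) ?d j" "\<xi> (Suc k) = \<xi> k + \<rho> ^ j *\<^sub>R ?d"
    using step[of k] unfolding lbfgs_step_def Let_def by blast
  have "0 \<le> - (gradient f (\<xi> k) \<bullet> ?d)"
    using \<open>0 < \<tau>\<^sub>1\<close> by (intro order_trans[OF _ lbfgs_direction_descent] assms(4)) auto
  then have "\<mu> * \<rho> ^ j * (gradient f (\<xi> k) \<bullet> ?d) \<le> 0"
    using assms(1,2) by (intro mult_nonneg_nonpos) auto
  then show "f (\<xi> (Suc k)) \<le> f (\<xi> k)"
    using j unfolding armijo_def by simp
qed

section \<open>Convergence of the algorithm\<close>

lemma lbfgs_accumulation_point_critical:
  fixes f :: "real^'m \<Rightarrow> real"
  assumes up: "\<And>x h. f (x + h) \<le> f x + gradient f x \<bullet> h + L * (norm h)\<^sup>2" and "0 < L"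
    and cont: "isCont (gradient f) x" and below: "\<And>x. m \<le> f x"
    and "0 < K" "0 < \<mu>" "\<mu> < 1" "0 < \<rho>" "\<rho> < 1" "0 < \<tau>\<^sub>1" "0 < \<tau>\<^sub>2"
    and Q0: "\<And>k. pos_def (Q0 k)"
    and step: "\<And>k. lbfgs_step f mem K \<mu> \<rho> \<tau>\<^sub>1 \<tau>\<^sub>2 Q0 \<xi> k"
    and r: "strict_mono r" "(\<xi> \<circ> r) \<longlonglongrightarrow> x"
  shows "gradient f x = 0"
proof (rule ccontr)
  assume "gradient f x \<noteq> 0"
  define G where "G = norm (gradient f x)"
  have "0 < G"
    using \<open>gradient f x \<noteq> 0\<close> by (simp add: G_def)
  \<comment> \<open>Near \<open>x\<close> the gradient norm lies between \<open>G / 2\<close> and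
    \<open>2 * G\<close>: the lower end fixes the slope bound \<open>\<delta>\<close>, the upper end
    the length bound \<open>D\<close>, and \<open>\<kappa>\<close> is the resulting
    decrease.\<close>
  define \<delta> where "\<delta> = \<tau>\<^sub>1 * (G / 2) powr \<tau>\<^sub>2 * (G / 2)\<^sup>2"
  define D where "D = max K (\<tau>\<^sub>1 * (2 * G) powr \<tau>\<^sub>2 * (2 * G))"
  define \<kappa> where "\<kappa> = \<mu> * min 1 (\<rho> * (1 - \<mu>) * \<delta> / (L * D\<^sup>2)) * \<delta>"
  have pos: "0 < \<delta>" "0 < D"
    using \<open>0 < G\<close> \<open>0 < \<tau>\<^sub>1\<close> \<open>0 < K\<close> by (auto simp: \<delta>_def D_def)
  then have "0 < \<kappa>"
    using assms by (simp add: \<kappa>_def)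
  have decrease: "\<kappa> \<le> f (\<xi> k) - f (\<xi> (Suc k))"
    if k: "G / 2 < norm (gradient f (\<xi> k))" "norm (gradient f (\<xi> k)) < 2 * G" for k
  proof -
    have "\<delta> \<le> \<tau>\<^sub>1 * norm (gradient f (\<xi> k)) powr \<tau>\<^sub>2 * (norm (gradient f (\<xi> k)))\<^sup>2"
      unfolding \<delta>_def using k \<open>0 < G\<close> \<open>0 < \<tau>\<^sub>1\<close> \<open>0 < \<tau>\<^sub>2\<close>
      by (intro mult_mono powr_mono2 power_mono) auto
    also have "\<dots> \<le> - (gradient f (\<xi> k) \<bullet> lbfgs_direction f mem K \<tau>\<^sub>1 \<tau>\<^sub>2 Q0 \<xi> k)"
      by (intro lbfgs_direction_descent Q0)
    finally have \<delta>: "\<delta> \<le> \<dots>" .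
    have "norm (lbfgs_direction f mem K \<tau>\<^sub>1 \<tau>\<^sub>2 Q0 \<xi> k)
        \<le> max K (\<tau>\<^sub>1 * norm (gradient f (\<xi> k)) powr \<tau>\<^sub>2 * norm (gradient f (\<xi> k)))"
      by (intro norm_lbfgs_direction_le \<open>0 < \<tau>\<^sub>1\<close>)
    also have "\<dots> \<le> D"
      unfolding D_def using k \<open>0 < \<tau>\<^sub>1\<close> \<open>0 < \<tau>\<^sub>2\<close>
      by (intro max.mono mult_mono powr_mono2) auto
    finally have "norm (lbfgs_direction f mem K \<tau>\<^sub>1 \<tau>\<^sub>2 Q0 \<xi> k) \<le> D" .
    from lbfgs_step_decrease[of f L, OF up \<open>0 < L\<close> \<open>0 < \<mu>\<close> \<open>\<mu> < 1\<close> \<open>0 < \<rho>\<close> \<open>\<rho> < 1\<close>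
        step less_imp_le[OF pos(1)] \<delta> pos(2) this]
    show ?thesis
      by (simp add: \<kappa>_def)
  qed
  have "(\<lambda>i. norm (gradient f ((\<xi> \<circ> r) i))) \<longlonglongrightarrow> G"
    unfolding G_def by (intro tendsto_norm isCont_tendsto_compose[OF cont] r(2))
  from order_tendstoD(1)[OF this, of "G / 2"] order_tendstoD(2)[OF this, of "2 * G"] \<open>0 < G\<close>
  have "\<forall>\<^sub>F i in sequentially. G / 2 < norm (gradient f ((\<xi> \<circ> r) i))"
      "\<forall>\<^sub>F i in sequentially. norm (gradient f ((\<xi> \<circ> r) i)) < 2 * G"
    by simp_all
  then have ge: "\<forall>\<^sub>F i in sequentially. \<kappa> \<le> f (\<xi> (r i)) - f (\<xi> (Suc (r i)))"
    by eventually_elim (simp add: decrease)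
  have "decseq (\<lambda>k. f (\<xi> k))"
    using assms by (intro lbfgs_decseq)
  then obtain l where l: "(\<lambda>k. f (\<xi> k)) \<longlonglongrightarrow> l"
    using decseq_convergent[of "\<lambda>k. f (\<xi> k)" m] below by blast
  \<comment> \<open>Differences of consecutive values vanish along the whole sequence, hence along
    \<open>r\<close>, against the fixed decrease \<open>\<kappa>\<close>.\<close>
  have "(\<lambda>k. f (\<xi> k) - f (\<xi> (Suc k))) \<longlonglongrightarrow> l - l"
    by (intro tendsto_diff l LIMSEQ_Suc)
  from LIMSEQ_subseq_LIMSEQ[OF this r(1)]
  have "(\<lambda>i. f (\<xi> (r i)) - f (\<xi> (Suc (r i)))) \<longlonglongrightarrow> 0"
    by (simp add: comp_def)
  from order_tendstoD(2)[OF this \<open>0 < \<kappa>\<close>] ge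
  have "\<forall>\<^sub>F i in sequentially. False"
    by eventually_elim simp
  then show False
    by simp
qed

theorem theorem5:
  fixes A :: "real^'n^'n \<Rightarrow> real^'m" and b :: "real^'m" and Z :: "real^'n^'n"
    and \<xi>\<^sub>0 :: "real^'m" and mem :: nat and K \<mu> \<rho> \<tau>\<^sub>1 \<tau>\<^sub>2 :: real
    and Q0 :: "nat \<Rightarrow> real^'m^'m"
  assumes "linear_on_sym A"
    and "Z \<in> sym_mats"
    and "bij (\<lambda>\<xi>. A (sym_adjoint A \<xi>))"
    and "slater A b"
    and "mem > 0" and "K > 0" and "0 < \<mu>" and "\<mu> < 1/2" and "0 < \<rho>" and "\<rho> < 1"
    and "\<tau>\<^sub>1 > 0" and "\<tau>\<^sub>2 > 0"
    and "\<And>k. pos_def (Q0 k)"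
  shows "\<comment> \<open>the algorithm is well defined\<close>
    (\<forall>\<xi> k. \<xi> 0 = \<xi>\<^sub>0 \<and>
        (\<forall>i<k. lbfgs_step (dual_objective A b Z) mem K \<mu> \<rho> \<tau>\<^sub>1 \<tau>\<^sub>2 Q0 \<xi> i) \<and>
        gradient (dual_objective A b Z) (\<xi> k) \<noteq> 0 \<longrightarrow>
      (let d = lbfgs_direction (dual_objective A b Z) mem K \<tau>\<^sub>1 \<tau>\<^sub>2 Q0 \<xi> k
       in gradient (dual_objective A b Z) (\<xi> k) \<bullet> d < 0 \<and>
          (\<exists>j. armijo (dual_objective A b Z) \<mu> \<rho> (\<xi> k) d j))) \<and>
    \<comment> \<open>boundedness and optimality of accumulation points\<close>
    (\<forall>\<xi>. \<xi> 0 = \<xi>\<^sub>0 \<and>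
        (\<forall>k. lbfgs_step (dual_objective A b Z) mem K \<mu> \<rho> \<tau>\<^sub>1 \<tau>\<^sub>2 Q0 \<xi> k) \<and>
        (\<forall>k. gradient (dual_objective A b Z) (\<xi> k) \<noteq> 0) \<longrightarrow>
      bounded (range \<xi>) \<and>
      (\<forall>\<xi>hat r. strict_mono r \<and> (\<xi> \<circ> r) \<longlonglongrightarrow> \<xi>hat \<longrightarrow>
        is_arg_min (dual_objective A b Z) (\<lambda>_. True) \<xi>hat))"
proof -
  let ?f = "dual_objective A b Z"
  \<comment> \<open>Equal values of the adjoint have equal images under \<open>A\<close>.\<close>
  have "inj (sym_adjoint A)"
    using assms(3) by (metis bij_is_inj injD injI)
  then obtain c m where c: "0 < c" "\<And>\<xi>. c * norm \<xi> - m \<le> ?f \<xi>"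
    using dual_objective_coercive assms(1,2,4) by blast
  have below: "- m \<le> ?f \<xi>" for \<xi>
    using c(1) mult_nonneg_nonneg[of c "norm \<xi>"] by (intro order_trans[OF _ c(2)]) simp
  obtain L where L: "0 < L" "\<And>x y. norm (gradient ?f y - gradient ?f x) \<le> L * norm (y - x)"
    using gradient_dual_objective_lipschitz[OF assms(1)] by blast
  have deriv: "GDERIV ?f x :> gradient ?f x" for x
    using gradient_dual_objective[OF assms(1)] by simp
  have up: "?f (x + h) \<le> ?f x + gradient ?f x \<bullet> h + L * (norm h)\<^sup>2" for x h
    by (rule lipschitz_gradient_upper_bound[OF deriv L(2)])
  have "L-lipschitz_on UNIV (gradient ?f)"
    using L by (intro lipschitz_onI) (auto simp: dist_norm)
  then have cont: "isCont (gradient ?f) x" for x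
    using lipschitz_on_continuous_on[of L UNIV "gradient ?f"]
    by (simp add: continuous_on_eq_continuous_at)
  have "\<mu> < 1"
    using assms(8) by simp
  show ?thesis
  proof (intro conjI allI impI; elim conjE)
    fix \<xi> :: "nat \<Rightarrow> real^'m" and k
    let ?d = "lbfgs_direction ?f mem K \<tau>\<^sub>1 \<tau>\<^sub>2 Q0 \<xi> k"
    assume "gradient ?f (\<xi> k) \<noteq> 0"
    then have "0 < \<tau>\<^sub>1 * norm (gradient ?f (\<xi> k)) powr \<tau>\<^sub>2 * (norm (gradient ?f (\<xi> k)))\<^sup>2"
      using \<open>\<tau>\<^sub>1 > 0\<close> by simp
    also have "\<dots> \<le> - (gradient ?f (\<xi> k) \<bullet> ?d)"
      by (intro lbfgs_direction_descent assms)
    finally have "gradient ?f (\<xi> k) \<bullet> ?d < 0"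
      by simp
    moreover from this have "\<exists>j. armijo ?f \<mu> \<rho> (\<xi> k) ?d j"
      by (rule armijo_terminates[of ?f L, OF up \<open>0 < \<rho>\<close> \<open>\<rho> < 1\<close> \<open>\<mu> < 1\<close>])
    ultimately show "let d = ?d in gradient ?f (\<xi> k) \<bullet> d < 0 \<and> (\<exists>j. armijo ?f \<mu> \<rho> (\<xi> k) d j)"
      by (simp add: Let_def)
  next
    fix \<xi> :: "nat \<Rightarrow> real^'m"
    assume step: "\<forall>k. lbfgs_step ?f mem K \<mu> \<rho> \<tau>\<^sub>1 \<tau>\<^sub>2 Q0 \<xi> k"
    have dec: "decseq (\<lambda>k. ?f (\<xi> k))"
      by (rule lbfgs_decseq[where ?Q0.0 = Q0, OF assms(7,9,11,13) step[rule_format]])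
    \<comment> \<open>All iterates stay in the initial sublevel set, which coercivity
      bounds.\<close>
    have "norm (\<xi> k) \<le> (?f (\<xi> 0) + m) / c" for k
      using c(1) c(2)[of "\<xi> k"] decseqD[OF dec, of 0 k]
      by (simp add: pos_le_divide_eq mult.commute[of _ c])
    then show "bounded (range \<xi>)"
      by (auto simp: bounded_iff)
  next
    fix \<xi> :: "nat \<Rightarrow> real^'m" and \<xi>hat r
    assume step: "\<forall>k. lbfgs_step ?f mem K \<mu> \<rho> \<tau>\<^sub>1 \<tau>\<^sub>2 Q0 \<xi> k"
      and r: "strict_mono r" "(\<xi> \<circ> r) \<longlonglongrightarrow> \<xi>hat"
    have "gradient ?f \<xi>hat = 0"
      by (rule lbfgs_accumulation_point_critical[where ?Q0.0 = Q0, OF up L(1) cont below assms(6,7)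
          \<open>\<mu> < 1\<close> assms(9-13) step[rule_format] r])
    then have "?f \<xi>hat \<le> ?f y" for y
      using monotone_gradient_lower_bound[OF deriv gradient_dual_objective_monotone[OF assms(1)],
          of \<xi>hat "y - \<xi>hat"] by simp
    then show "is_arg_min ?f (\<lambda>_. True) \<xi>hat"
      by (simp add: is_arg_min_def not_less)
  qed
qed

end
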